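(* For every integer $n\geq 12$, the signed Roman domination number of the graph $Q_n$ satisfies $\frac{2n}{3}\leq\gamma_{sR}(Q_n)\leq n$.
   Context: Graphs are finite, undirected and simple. For a vertex $v$ of a graph $G=(V,E)$, $N(v)=\{u\in V\mid uv\in E\}$ and $N[v]=N(v)\cup\{v\}$. A signed Roman domination (SRD) function on $G$ is a function $f:V\to\{-1,1,2\}$ such that (i) $\sum_{u\in N[v]}f(u)\geq 1$ for every $v\in V$, and (ii) every $v\in V$ with $f(v)=-1$ has a neighbor $u\in N(v)$ with $f(u)=2$. The weight of $f$ is $f(V)=\sum_{v\in V}f(v)$, and the signed Roman domination number $\gamma_{sR}(G)$ is the minimum weight of an SRD function on $G$. The graph $Q_n$ has $4n$ distinct vertices $V(Q_n)=\{a_i,b_i,c_i,d_i\mid i=0,\ldots,n-1\}$ and edge set $E(Q_n)=\{a_ia_{i+1},\,b_ib_{i+1},\,d_id_{i+1},\,a_ib_i,\,b_ic_i,\,c_id_i,\,b_{i+1}c_i\mid i=0,\ldots,n-1\}$, with vertex indices taken modulo $n$. *)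

theory Defs
  imports Complex_Main
begin

text \<open>A graph is a pair of a vertex set and a set of edges, an edge being the set of its
  two end vertices.\<close>

type_synonym 'a graph = "'a set \<times> 'a set set"

abbreviation verts :: "'a graph \<Rightarrow> 'a set" where
  "verts G \<equiv> fst G"

abbreviation edges :: "'a graph \<Rightarrow> 'a set set" where
  "edges G \<equiv> snd G"

definition simple_graph :: "'a graph \<Rightarrow> bool" where
  "simple_graph G \<longleftrightarrow>
     finite (verts G) \<and> (\<forall>e\<in>edges G. e \<subseteq> verts G \<and> card e = 2)"

definition nbhd :: "'a graph \<Rightarrow> 'a \<Rightarrow> 'a set" where
  "nbhd G v = {u \<in> verts G. {u, v} \<in> edges G}"

definition closed_nbhd :: "'a graph \<Rightarrow> 'a \<Rightarrow> 'a set" where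
  "closed_nbhd G v = nbhd G v \<union> {v}"

definition srd_function :: "'a graph \<Rightarrow> ('a \<Rightarrow> int) \<Rightarrow> bool" where
  "srd_function G f \<longleftrightarrow>
     (\<forall>v\<in>verts G. f v \<in> {-1, 1, 2}) \<and>
     (\<forall>v\<in>verts G. (\<Sum>u\<in>closed_nbhd G v. f u) \<ge> 1) \<and>
     (\<forall>v\<in>verts G. f v = -1 \<longrightarrow> (\<exists>u\<in>nbhd G v. f u = 2))"

definition weight :: "'a graph \<Rightarrow> ('a \<Rightarrow> int) \<Rightarrow> int" where
  "weight G f = (\<Sum>v\<in>verts G. f v)"

definition srd_number :: "'a graph \<Rightarrow> int" where
  "srd_number G = Min {weight G f | f. srd_function G f}"

text \<open>For a simple graph the minimum is over a nonempty finite set, so it is attained.\<close>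

lemma finite_srd_weights: "finite {weight G f | f. srd_function G f}"
proof (rule finite_subset)
  show "{weight G f | f. srd_function G f} \<subseteq> {- int (card (verts G)) .. 2 * int (card (verts G))}"
  proof
    fix w assume "w \<in> {weight G f | f. srd_function G f}"
    then obtain f where w: "w = weight G f" and "srd_function G f" by blast
    then have b: "\<And>v. v \<in> verts G \<Longrightarrow> -1 \<le> f v \<and> f v \<le> 2"
      by (force simp: srd_function_def)
    have "(\<Sum>v\<in>verts G. -1) \<le> weight G f" "weight G f \<le> (\<Sum>v\<in>verts G. 2)"
      unfolding weight_def by (rule sum_mono, use b in blast)+
    then show "w \<in> {- int (card (verts G)) .. 2 * int (card (verts G))}"
      by (simp add: w)
  qed
qed simp

lemma srd_weights_nonempty:
  assumes "simple_graph G"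
  shows "{weight G f | f. srd_function G f} \<noteq> {}"
proof -
  have fin: "finite (closed_nbhd G v)" for v
    using assms by (simp add: simple_graph_def closed_nbhd_def nbhd_def)
  have "card (closed_nbhd G v) > 0" for v
    using fin[of v] by (auto simp: card_gt_0_iff closed_nbhd_def)
  then have "int (card (closed_nbhd G v)) \<ge> 1" for v
    by (metis of_nat_0_less_iff int_one_le_iff_zero_less)
  then have "srd_function G (\<lambda>_. 1)"
    by (simp add: srd_function_def)
  then show ?thesis by blast
qed

datatype Q_vertex = A nat | B nat | C nat | D nat

definition Q :: "nat \<Rightarrow> Q_vertex graph" where
  "Q n =
    ((\<Union>i<n. {A i, B i, C i, D i}),
     (\<Union>i<n. let j = (i + 1) mod n in
        {{A i, A j}, {B i, B j}, {D i, D j},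
         {A i, B i}, {B i, C i}, {C i, D i}, {B j, C i}}))"

lemma simple_graph_Q:
  assumes "n \<ge> 2"
  shows "simple_graph (Q n)"
proof -
  have "(i + 1) mod n < n \<and> i \<noteq> (i + 1) mod n" if "i < n" for i
    using assms that by (cases "i + 1 = n") auto
  then have "e \<subseteq> verts (Q n) \<and> card e = 2" if "e \<in> edges (Q n)" for e
    using that by (fastforce simp del: mod_Suc simp: Q_def Let_def)
  then show ?thesis
    by (simp add: simple_graph_def Q_def)
qed

end

theory Submission
  imports Defs
begin

text \<open>
  Lower bound: write \<open>a, b, c, d\<close> for the total weights of the four vertex classes. Summing the
  neighbourhood condition over a class gives \<open>3a + b \<ge> n\<close>, \<open>a + 3b + 2c \<ge> n\<close> and
  \<open>c + 3d \<ge> n\<close>. The combination with coefficients \<open>1/4, 1/4, 1/3\<close>, together with \<open>c/6 \<ge> -n/6\<close>,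
  is \<open>a + b + c + d \<ge> 2n/3\<close>.

  Upper bound: there are two closed walks of columns, of lengths \<open>3\<close> and \<open>7\<close>, through a common pair
  of consecutive columns, such that three consecutive columns always satisfy the local conditions at
  the middle one, and each walk has average column weight \<open>1\<close>. They can be concatenated, and every
  \<open>n \<ge> 12\<close> is of the form \<open>3x + 7y\<close>.
\<close>

section \<open>Cyclic shifts of column indices\<close>

definition cyc_succ :: "nat \<Rightarrow> nat \<Rightarrow> nat" where
  "cyc_succ n i = (if Suc i = n then 0 else Suc i)"

definition cyc_pred :: "nat \<Rightarrow> nat \<Rightarrow> nat" where
  "cyc_pred n i = (if i = 0 then n - 1 else i - 1)"

lemma cyc_succ_less: "i < n \<Longrightarrow> cyc_succ n i < n"
  and cyc_pred_less: "i < n \<Longrightarrow> cyc_pred n i < n"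
  and cyc_succ_pred: "i < n \<Longrightarrow> cyc_succ n (cyc_pred n i) = i"
  and cyc_pred_succ: "i < n \<Longrightarrow> cyc_pred n (cyc_succ n i) = i"
  by (auto simp: cyc_succ_def cyc_pred_def)

lemma cyc_succ_neq: "n \<ge> 2 \<Longrightarrow> cyc_succ n i \<noteq> i"
  and cyc_pred_neq: "n \<ge> 2 \<Longrightarrow> cyc_pred n i \<noteq> i"
  and cyc_succ_neq_pred: "n \<ge> 3 \<Longrightarrow> cyc_succ n i \<noteq> cyc_pred n i"
  by (auto simp: cyc_succ_def cyc_pred_def)

lemma cyc_succ_eq_iff: "i < n \<Longrightarrow> j < n \<Longrightarrow> cyc_succ n j = i \<longleftrightarrow> j = cyc_pred n i"
  using cyc_succ_pred cyc_pred_succ by metis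

text \<open>A cyclic shift permutes the indices, so a shifted copy of a vertex class has the same
  total as the class.\<close>

lemma sum_cyc_succ: "(\<Sum>i<n. g (cyc_succ n i)) = (\<Sum>i<n. g i)"
  by (rule sum.reindex_bij_witness[of _ "cyc_pred n" "cyc_succ n"])
    (auto simp: cyc_succ_pred cyc_pred_succ intro: cyc_succ_less cyc_pred_less)

lemma sum_cyc_pred: "(\<Sum>i<n. g (cyc_pred n i)) = (\<Sum>i<n. g i)"
  by (rule sum.reindex_bij_witness[of _ "cyc_succ n" "cyc_pred n"])
    (auto simp: cyc_succ_pred cyc_pred_succ intro: cyc_succ_less cyc_pred_less)

section \<open>Neighbourhoods and weights in \<open>Q n\<close>\<close>

lemma verts_Q: "verts (Q n) = A ` {..<n} \<union> B ` {..<n} \<union> C ` {..<n} \<union> D ` {..<n}"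
  by (auto simp: Q_def)

lemma edges_Q:
  "edges (Q n) = (\<Union>i<n.
     {{A i, A (cyc_succ n i)}, {B i, B (cyc_succ n i)}, {D i, D (cyc_succ n i)},
      {A i, B i}, {B i, C i}, {C i, D i}, {B (cyc_succ n i), C i}})"
proof -
  have "(i + 1) mod n = cyc_succ n i" if "i < n" for i
    using that by (auto simp: cyc_succ_def)
  then show ?thesis
    by (simp add: Q_def Let_def)
qed

lemma nbhd_Q:
  assumes "i < n"
  shows "nbhd (Q n) (A i) = {A (cyc_pred n i), A (cyc_succ n i), B i}"
    and "nbhd (Q n) (B i) =
      {B (cyc_pred n i), B (cyc_succ n i), A i, C i, C (cyc_pred n i)}"
    and "nbhd (Q n) (C i) = {B i, B (cyc_succ n i), D i}"
    and "nbhd (Q n) (D i) = {D (cyc_pred n i), D (cyc_succ n i), C i}"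
  using assms
  by (auto simp: nbhd_def verts_Q edges_Q doubleton_eq_iff cyc_succ_eq_iff cyc_succ_less
      cyc_pred_less cyc_succ_pred cyc_pred_succ)

text \<open>For \<open>n \<ge> 3\<close> a column and its two cyclic neighbours are distinct, so no
  vertex occurs twice in these sums.\<close>

lemma sum_closed_nbhd_Q:
  fixes f :: "Q_vertex \<Rightarrow> int"
  assumes "n \<ge> 3" "i < n"
  shows "sum f (closed_nbhd (Q n) (A i)) = f (A i) + f (A (cyc_pred n i)) + f (A (cyc_succ n i)) + f (B i)"
    and "sum f (closed_nbhd (Q n) (B i)) =
      f (B i) + f (B (cyc_pred n i)) + f (B (cyc_succ n i)) + f (A i) + f (C i) + f (C (cyc_pred n i))"
    and "sum f (closed_nbhd (Q n) (C i)) = f (C i) + f (B i) + f (B (cyc_succ n i)) + f (D i)"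
    and "sum f (closed_nbhd (Q n) (D i)) = f (D i) + f (D (cyc_pred n i)) + f (D (cyc_succ n i)) + f (C i)"
  using assms cyc_succ_neq[of n i] cyc_pred_neq[of n i] cyc_succ_neq_pred[of n i]
  by (simp_all add: closed_nbhd_def nbhd_Q)

lemma weight_Q:
  "weight (Q n) f = (\<Sum>i<n. f (A i)) + (\<Sum>i<n. f (B i)) + (\<Sum>i<n. f (C i)) + (\<Sum>i<n. f (D i))"
proof -
  have "weight (Q n) f
      = sum f (A ` {..<n}) + sum f (B ` {..<n}) + sum f (C ` {..<n}) + sum f (D ` {..<n})"
    unfolding weight_def verts_Q
    by (subst sum.union_disjoint, auto)+
  then show ?thesis
    by (simp add: sum.reindex inj_on_def)
qed

lemma srd_number_Q_attained:
  assumes "n \<ge> 2"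
  obtains f where "srd_function (Q n) f" "srd_number (Q n) = weight (Q n) f"
  using Min_in[OF finite_srd_weights srd_weights_nonempty[OF simple_graph_Q[OF assms]]]
  unfolding srd_number_def by blast

section \<open>Lower bound by summing over vertex classes\<close>

lemma srd_weight_Q_ge:
  assumes n: "n \<ge> 3" and f: "srd_function (Q n) f"
  shows "3 * weight (Q n) f \<ge> 2 * int n"
proof -
  define a b c d where "a = (\<Sum>i<n. f (A i))" and "b = (\<Sum>i<n. f (B i))"
    and "c = (\<Sum>i<n. f (C i))" and "d = (\<Sum>i<n. f (D i))"
  have closed: "sum f (closed_nbhd (Q n) v) \<ge> 1" if "v \<in> verts (Q n)" for v
    using f that by (simp add: srd_function_def)
  have avg: "int n \<le> (\<Sum>i<n. sum f (closed_nbhd (Q n) (X i)))"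
    if "\<And>i. i < n \<Longrightarrow> X i \<in> verts (Q n)" for X
    using sum_mono[of "{..<n}" "\<lambda>_. 1" "\<lambda>i. sum f (closed_nbhd (Q n) (X i))"] closed that
    by simp
  have "int n \<le> 3 * a + b"
    using avg[of A] n
    by (simp add: verts_Q sum_closed_nbhd_Q sum.distrib a_def b_def
        sum_cyc_succ[of "\<lambda>i. f (A i)"] sum_cyc_pred[of "\<lambda>i. f (A i)"])
  moreover have "int n \<le> a + 3 * b + 2 * c"
    using avg[of B] n
    by (simp add: verts_Q sum_closed_nbhd_Q sum.distrib a_def b_def c_def
        sum_cyc_succ[of "\<lambda>i. f (B i)"] sum_cyc_pred[of "\<lambda>i. f (B i)"]
        sum_cyc_pred[of "\<lambda>i. f (C i)"])
  moreover have "int n \<le> c + 3 * d"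
    using avg[of D] n
    by (simp add: verts_Q sum_closed_nbhd_Q sum.distrib c_def d_def
        sum_cyc_succ[of "\<lambda>i. f (D i)"] sum_cyc_pred[of "\<lambda>i. f (D i)"])
  moreover have "- int n \<le> c"
  proof -
    have "f (C i) \<ge> -1" if "i < n" for i
    proof -
      have "f (C i) \<in> {-1, 1, 2}"
        using f that by (simp add: srd_function_def verts_Q)
      then show ?thesis by auto
    qed
    then show ?thesis
      using sum_mono[of "{..<n}" "\<lambda>_. -1" "\<lambda>i. f (C i)"] by (simp add: c_def)
  qed
  \<comment> \<open>The first inequality is half the sum of those from \<open>A\<close> and
    \<open>B\<close>. Three times the first, twice the second and the third together give that six
    times the weight is at least \<open>4 * int n\<close>.\<close>
  ultimately have "int n \<le> 2 * a + 2 * b + c" "int n \<le> c + 3 * d" "- int n \<le> c"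
    by linarith+
  then show ?thesis
    unfolding weight_Q a_def[symmetric] b_def[symmetric] c_def[symmetric] d_def[symmetric]
    by presburger
qed

section \<open>Upper bound by concatenated column walks\<close>

text \<open>The columns of the two closed walks are numbered \<open>0, \<dots>, 6\<close>; the walks are
  \<open>0 1 6\<close> and \<open>0 1 2 3 4 5 6\<close>.\<close>

definition column_step :: "(nat \<times> nat) set" where
  "column_step = {(0, 1), (1, 2), (1, 6), (2, 3), (3, 4), (4, 5), (5, 6), (6, 0)}"

definition col_a :: "nat \<Rightarrow> int" where "col_a k = [-1, 2, -1, 1, -1, 2, -1] ! k"
definition col_b :: "nat \<Rightarrow> int" where "col_b k = [2, 1, -1, 2, -1, 1, 1] ! k"
definition col_c :: "nat \<Rightarrow> int" where "col_c k = [-1, -1, 1, 1, -1, -1, -1] ! k"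
definition col_d :: "nat \<Rightarrow> int" where "col_d k = [1, 2, -1, -1, 2, 2, -1] ! k"

text \<open>The accumulated excess of column weights over \<open>1\<close>, starting from column 0,
  when column \<open>k\<close> is reached. Both successors of column 1 have value 3, so one function
  serves both walks.\<close>

definition col_potential :: "nat \<Rightarrow> int" where
  "col_potential k = [0, 0, 3, 0, 2, 0, 3] ! k"

lemmas col_defs = col_a_def col_b_def col_c_def col_d_def

primrec columns_fun :: "(nat \<Rightarrow> nat) \<Rightarrow> Q_vertex \<Rightarrow> int" where
  "columns_fun p (A i) = col_a (p i)"
| "columns_fun p (B i) = col_b (p i)"
| "columns_fun p (C i) = col_c (p i)"
| "columns_fun p (D i) = col_d (p i)"

lemma column_weight_step:
  assumes "(j, k) \<in> column_step"
  shows "col_a j + col_b j + col_c j + col_d j = 1 + col_potential k - col_potential j"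
  using assms by (auto simp: column_step_def col_defs col_potential_def)

lemma column_value:
  assumes "(j, k) \<in> column_step"
  shows "col_a j \<in> {-1, 1, 2}" "col_b j \<in> {-1, 1, 2}" "col_c j \<in> {-1, 1, 2}" "col_d j \<in> {-1, 1, 2}"
  using assms by (auto simp: column_step_def col_defs)

text \<open>A finite check over the nine paths of length two in \<open>column_step\<close>; both
  ways of leaving and of re-entering the shared stretch 6, 0, 1 are among them.\<close>

lemma column_closed_nbhd:
  assumes "(h, j) \<in> column_step" "(j, k) \<in> column_step"
  shows "col_a j + col_a h + col_a k + col_b j \<ge> 1"
    and "col_b j + col_b h + col_b k + col_a j + col_c j + col_c h \<ge> 1"
    and "col_c j + col_b j + col_b k + col_d j \<ge> 1"
    and "col_d j + col_d h + col_d k + col_c j \<ge> 1"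
  using assms by (auto simp: column_step_def col_defs)

lemma column_two:
  assumes "(h, j) \<in> column_step" "(j, k) \<in> column_step"
  shows "col_a j = -1 \<Longrightarrow> col_a h = 2 \<or> col_a k = 2 \<or> col_b j = 2"
    and "col_b j = -1 \<Longrightarrow>
      col_b h = 2 \<or> col_b k = 2 \<or> col_a j = 2 \<or> col_c j = 2 \<or> col_c h = 2"
    and "col_c j = -1 \<Longrightarrow> col_b j = 2 \<or> col_b k = 2 \<or> col_d j = 2"
    and "col_d j = -1 \<Longrightarrow> col_d h = 2 \<or> col_d k = 2 \<or> col_c j = 2"
  using assms by (auto simp: column_step_def col_defs)

text \<open>Every edge stays in a column or joins cyclically adjacent ones, so the conditions at a
  vertex involve only three consecutive columns.\<close>

lemma srd_function_columns:
  assumes n: "n \<ge> 3"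
    and step: "\<And>i. i < n \<Longrightarrow> (p i, p (cyc_succ n i)) \<in> column_step"
  shows "srd_function (Q n) (columns_fun p)"
proof -
  have pre: "(p (cyc_pred n i), p i) \<in> column_step" if "i < n" for i
    using step[OF cyc_pred_less[OF that]] cyc_succ_pred[OF that] by simp
  have "columns_fun p v \<in> {-1, 1, 2}
      \<and> (\<Sum>u\<in>closed_nbhd (Q n) v. columns_fun p u) \<ge> 1
      \<and> (columns_fun p v = -1 \<longrightarrow> (\<exists>u\<in>nbhd (Q n) v. columns_fun p u = 2))"
    if "v \<in> verts (Q n)" for v
  proof -
    from that obtain i where i: "i < n" and v: "v \<in> {A i, B i, C i, D i}"
      by (auto simp: verts_Q)
    note steps = pre[OF i] step[OF i]
    have "columns_fun p v \<in> {-1, 1, 2}"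
      using v column_value[OF steps(2)] by auto
    moreover have "(\<Sum>u\<in>closed_nbhd (Q n) v. columns_fun p u) \<ge> 1"
      using v column_closed_nbhd[OF steps] by (auto simp: sum_closed_nbhd_Q[OF n i])
    moreover have "\<exists>u\<in>nbhd (Q n) v. columns_fun p u = 2" if "columns_fun p v = -1"
      using v that column_two[OF steps] by (elim insertE emptyE) (simp_all add: nbhd_Q[OF i])
    ultimately show ?thesis by blast
  qed
  then show ?thesis
    by (simp add: srd_function_def)
qed

text \<open>The excess of each column over \<open>1\<close> is a potential difference, and these
  cancel around the cycle.\<close>

lemma weight_columns:
  assumes "\<And>i. i < n \<Longrightarrow> (p i, p (cyc_succ n i)) \<in> column_step"
  shows "weight (Q n) (columns_fun p) = int n"
proof -
  have "weight (Q n) (columns_fun p)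
      = (\<Sum>i<n. col_a (p i) + col_b (p i) + col_c (p i) + col_d (p i))"
    by (simp add: weight_Q sum.distrib)
  also have "\<dots> = (\<Sum>i<n. 1 + col_potential (p (cyc_succ n i)) - col_potential (p i))"
    using column_weight_step[OF assms] by (intro sum.cong) auto
  also have "\<dots> = int n"
    by (simp add: sum.distrib sum_subtractf sum_cyc_succ[of "\<lambda>i. col_potential (p i)"])
  finally show ?thesis .
qed

text \<open>For \<open>n \<equiv> y\<close> modulo \<open>3\<close> with \<open>y \<le> 2\<close>, take \<open>y\<close> copies of the long walk, as
  \<open>7 \<equiv> 1\<close> modulo \<open>3\<close>, and then the short one.\<close>

definition column_walk :: "nat \<Rightarrow> nat \<Rightarrow> nat" where
  "column_walk y i =
    (if i < 7 * y then i mod 7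
     else if (i - 7 * y) mod 3 = 2 then 6 else (i - 7 * y) mod 3)"

lemma column_walk_Suc: "(column_walk y i, column_walk y (Suc i)) \<in> column_step"
proof (cases "Suc i < 7 * y")
  case True
  then show ?thesis
    using mod_less_divisor[of 7 i]
    by (auto simp: column_walk_def column_step_def mod_Suc)
next
  case False
  show ?thesis
  proof (cases "i < 7 * y")
    case True
    \<comment> \<open>The junction from long to short walks: a long walk ends in column 6 and the
      short one starts in column 0.\<close>
    with False have "Suc i = 7 * y" by simp
    moreover from this have "i mod 7 = 6" by presburger
    ultimately show ?thesis
      by (simp add: column_walk_def column_step_def)
  next
    case False
    then have "Suc i - 7 * y = Suc (i - 7 * y)" by simp
    moreover have "(i - 7 * y) mod 3 \<in> {0, 1, 2}" by auto
    ultimately show ?thesis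
      using False by (auto simp: column_walk_def column_step_def mod_Suc)
  qed
qed

text \<open>The columns after the long walks number a multiple of 3, so position \<open>n\<close>
  would again carry column 0 and the wrap-around is an ordinary step.\<close>

lemma column_walk_cyc_succ:
  assumes "n \<ge> 12" "i < n"
  shows "(column_walk (n mod 3) i, column_walk (n mod 3) (cyc_succ n i)) \<in> column_step"
proof -
  have "n = 3 * (n div 3) + n mod 3" by simp
  moreover have "n mod 3 < 3" by simp
  \<comment> \<open>Here \<open>n \<ge> 12\<close> gives \<open>n div 3 \<ge> 4\<close>, which makes
    room for up to two long walks.\<close>
  moreover from calculation have "2 * (n mod 3) \<le> n div 3"
    using assms by linarith
  ultimately have le: "7 * (n mod 3) \<le> n"
    and "n - 7 * (n mod 3) = 3 * (n div 3 - 2 * (n mod 3))"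
    by linarith+
  then have "(n - 7 * (n mod 3)) mod 3 = 0"
    by (metis mod_mult_self1_is_0)
  then have "column_walk (n mod 3) n = column_walk (n mod 3) 0"
    using le by (simp add: column_walk_def)
  then show ?thesis
    using column_walk_Suc[of "n mod 3" i] by (auto simp: cyc_succ_def)
qed

theorem theorem6:
  fixes n :: nat
  assumes "n \<ge> 12"
  shows "2 * real n / 3 \<le> real_of_int (srd_number (Q n)) \<and> srd_number (Q n) \<le> int n"
proof
  obtain f where f: "srd_function (Q n) f" "srd_number (Q n) = weight (Q n) f"
    using srd_number_Q_attained[of n] assms by auto
  have "2 * int n \<le> 3 * srd_number (Q n)"
    using srd_weight_Q_ge[of n f] f assms by simp
  then have "real_of_int (2 * int n) \<le> real_of_int (3 * srd_number (Q n))"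
    by (simp only: of_int_le_iff)
  then show "2 * real n / 3 \<le> real_of_int (srd_number (Q n))"
    by simp
next
  let ?g = "columns_fun (column_walk (n mod 3))"
  have "srd_function (Q n) ?g" "weight (Q n) ?g = int n"
    using srd_function_columns weight_columns column_walk_cyc_succ assms by simp_all
  then have "int n \<in> {weight (Q n) f | f. srd_function (Q n) f}"
    by (metis (mono_tags, lifting) mem_Collect_eq)
  then show "srd_number (Q n) \<le> int n"
    unfolding srd_number_def by (rule Min_le[OF finite_srd_weights])
qed

end
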